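(* Let $\mathcal{C}$ be a category and $c$ an object of $\mathcal{C}$. If $\mathcal{C}$ is finite, acyclic, monic, and left locally totally ordered, then so are the slice category $\mathcal{C}/c$ and the coslice category $c\backslash\mathcal{C}$. Hence $\mathcal{C}/c$ and $c\backslash\mathcal{C}$ are weakly word-embeddable.
   Context: A finite category has finitely many objects and morphisms. A small category $\mathcal{C}$ is acyclic if for all distinct objects $c\neq d$, $\mathrm{Hom}(c,d)\neq\varnothing$ implies $\mathrm{Hom}(d,c)=\varnothing$, and $\mathrm{Hom}(c,c)=\{\mathrm{id}_c\}$ for every object $c$. A category is monic if every morphism is a monomorphism. A small category is left locally totally ordered if each hom-set $\mathrm{Hom}(c,d)$ can be equipped with a total order such that, for all objects $c,d,e$, every $g\colon d\to e$ and all $f_1,f_2\in\mathrm{Hom}(c,d)$, $f_1<f_2$ implies $g\circ f_1<g\circ f_2$. The slice category $\mathcal{C}/c$ has objects the pairs $(x,f)$ with $f\colon x\to c$; a morphism $(x,f)\to(y,g)$ is a morphism $h\colon x\to y$ with $g\circ h=f$. The coslice category $c\backslash\mathcal{C}$ has objects the pairs $(x,f)$ with $f\colon c\to x$; a morphism $(x,f)\to(y,g)$ is a morphism $h\colon x\to y$ with $h\circ f=g$. A word of length $n$ over an alphabet (set) $\Sigma$ is a function $w\colon[n]\to\Sigma$, where $[n]=\{1,\dots,n\}$. For words $w\colon[n]\to\Sigma$ and $w'\colon[m]\to\Sigma$, a subword inclusion $w'\to w$ is an injective order-preserving map $f\colon[m]\to[n]$ with $w\circ f=w'$. $\mathrm{Word}(\Sigma)$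 is the category of words over $\Sigma$ and subword inclusions, and $\mathrm{Sub}_w$ is its full subcategory spanned by all words that admit a morphism into $w$. A category $\mathcal{D}$ is weakly word-embeddable if there exist an alphabet $\Sigma$, a word $w$ over $\Sigma$, and a functor $\mathcal{D}\to\mathrm{Sub}_w$ that is faithful and injective on objects. *)

theory Defs
  imports Main "HOL-Library.FuncSet" "HOL-Library.Countable_Set"
begin

section \<open>Small categories\<close>

text \<open>
  A small category is given by a set of objects and a family of hom-sets. The hom-sets are
  not required to be disjoint, so identities and composition carry the objects as arguments:
  for f from x to y and g from y to z, the composite of g after f is
  \<open>Comp C x y z g f\<close>. Only values on objects and on elements of the hom-sets matter.
\<close>

record ('o, 'm) cat =
  Ob :: "'o set"
  Hom :: "'o \<Rightarrow> 'o \<Rightarrow> 'm set"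
  Idn :: "'o \<Rightarrow> 'm"
  Comp :: "'o \<Rightarrow> 'o \<Rightarrow> 'o \<Rightarrow> 'm \<Rightarrow> 'm \<Rightarrow> 'm"

locale category =
  fixes C :: "('o, 'm) cat"
  assumes Idn_in_Hom: "x \<in> Ob C \<Longrightarrow> Idn C x \<in> Hom C x x"
    and Comp_in_Hom:
      "\<lbrakk>x \<in> Ob C; y \<in> Ob C; z \<in> Ob C; f \<in> Hom C x y; g \<in> Hom C y z\<rbrakk>
        \<Longrightarrow> Comp C x y z g f \<in> Hom C x z"
    and Comp_Idn_right:
      "\<lbrakk>x \<in> Ob C; y \<in> Ob C; f \<in> Hom C x y\<rbrakk> \<Longrightarrow> Comp C x x y f (Idn C x) = f"
    and Comp_Idn_left:
      "\<lbrakk>x \<in> Ob C; y \<in> Ob C; f \<in> Hom C x y\<rbrakk> \<Longrightarrow> Comp C x y y (Idn C y) f = f"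
    and Comp_assoc:
      "\<lbrakk>x \<in> Ob C; y \<in> Ob C; z \<in> Ob C; u \<in> Ob C;
        f \<in> Hom C x y; g \<in> Hom C y z; h \<in> Hom C z u\<rbrakk>
        \<Longrightarrow> Comp C x z u h (Comp C x y z g f) = Comp C x y u (Comp C y z u h g) f"

text \<open>The set of morphisms is the disjoint union of the hom-sets.\<close>

definition Mor :: "('o, 'm) cat \<Rightarrow> ('o \<times> 'o \<times> 'm) set" where
  "Mor C = {(x, y, f). x \<in> Ob C \<and> y \<in> Ob C \<and> f \<in> Hom C x y}"

locale finite_category = category +
  assumes finite_Ob: "finite (Ob C)"
    and finite_Mor: "finite (Mor C)"

locale acyclic_category = category +
  assumes no_cycles:
      "\<lbrakk>x \<in> Ob C; y \<in> Ob C; x \<noteq> y; Hom C x y \<noteq> {}\<rbrakk> \<Longrightarrow> Hom C y x = {}"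
    and no_endomorphisms: "x \<in> Ob C \<Longrightarrow> Hom C x x = {Idn C x}"

definition monomorphism :: "('o, 'm) cat \<Rightarrow> 'o \<Rightarrow> 'o \<Rightarrow> 'm \<Rightarrow> bool" where
  "monomorphism C x y f \<longleftrightarrow> f \<in> Hom C x y \<and>
    (\<forall>u\<in>Ob C. \<forall>a\<in>Hom C u x. \<forall>b\<in>Hom C u x.
      Comp C u x y f a = Comp C u x y f b \<longrightarrow> a = b)"

locale monic_category = category +
  assumes all_mono: "\<lbrakk>x \<in> Ob C; y \<in> Ob C; f \<in> Hom C x y\<rbrakk> \<Longrightarrow> monomorphism C x y f"

text \<open>
  \<open>linear_order_on\<close> is reflexive, so the associated strict order is
  \<open>(f1, f2) \<in> r c d \<and> f1 \<noteq> f2\<close>.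
\<close>

locale left_locally_totally_ordered_category = category C for C :: "('o, 'm) cat" +
  assumes ex_left_compatible_order:
    "\<exists>r :: 'o \<Rightarrow> 'o \<Rightarrow> ('m \<times> 'm) set.
      (\<forall>c\<in>Ob C. \<forall>d\<in>Ob C. linear_order_on (Hom C c d) (r c d)) \<and>
      (\<forall>c\<in>Ob C. \<forall>d\<in>Ob C. \<forall>e\<in>Ob C.
        \<forall>g\<in>Hom C d e. \<forall>f1\<in>Hom C c d. \<forall>f2\<in>Hom C c d.
          (f1, f2) \<in> r c d \<and> f1 \<noteq> f2 \<longrightarrow>
          (Comp C c d e g f1, Comp C c d e g f2) \<in> r c e \<and>
          Comp C c d e g f1 \<noteq> Comp C c d e g f2)"


section \<open>Slice and coslice categories\<close>

definition slice :: "('o, 'm) cat \<Rightarrow> 'o \<Rightarrow> ('o \<times> 'm, 'm) cat" where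
  "slice C c = \<lparr>
    Ob = {(x, f). x \<in> Ob C \<and> f \<in> Hom C x c},
    Hom = (\<lambda>(x, f) (y, g). {h \<in> Hom C x y. Comp C x y c g h = f}),
    Idn = (\<lambda>(x, f). Idn C x),
    Comp = (\<lambda>(x, _) (y, _) (z, _). Comp C x y z)\<rparr>"

definition coslice :: "('o, 'm) cat \<Rightarrow> 'o \<Rightarrow> ('o \<times> 'm, 'm) cat" where
  "coslice C c = \<lparr>
    Ob = {(x, f). x \<in> Ob C \<and> f \<in> Hom C c x},
    Hom = (\<lambda>(x, f) (y, g). {h \<in> Hom C x y. Comp C c x y h f = g}),
    Idn = (\<lambda>(x, f). Idn C x),
    Comp = (\<lambda>(x, _) (y, _) (z, _). Comp C x y z)\<rparr>"

lemma (in category) category_slice: "c \<in> Ob C \<Longrightarrow> category (slice C c)"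
  by unfold_locales
    (auto simp: slice_def Idn_in_Hom Comp_in_Hom Comp_Idn_right Comp_Idn_left Comp_assoc)

lemma (in category) category_coslice: "c \<in> Ob C \<Longrightarrow> category (coslice C c)"
proof (unfold_locales, goal_cases)
  case (2 x y z f g)
  then show ?case
    by (auto simp: coslice_def Comp_in_Hom Comp_assoc[symmetric])
qed (auto simp: coslice_def Idn_in_Hom Comp_in_Hom Comp_Idn_right Comp_Idn_left Comp_assoc)


section \<open>Words\<close>

text \<open>
  The pair \<open>(n, w)\<close> is the word of length n given by the function w from
  \<open>{1..n}\<close> to the alphabet. Functions on \<open>{1..n}\<close> are extensional
  (\<open>undefined\<close> outside), so that equality of pairs is equality of words and equality of
  subword inclusions is equality of maps.
\<close>

type_synonym 'l word = "nat \<times> (nat \<Rightarrow> 'l)"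

definition words :: "'l set \<Rightarrow> 'l word set" where
  "words \<Sigma> = {(n, w). w \<in> {1..n} \<rightarrow>\<^sub>E \<Sigma>}"

fun subword_inclusions :: "'l word \<Rightarrow> 'l word \<Rightarrow> (nat \<Rightarrow> nat) set" where
  "subword_inclusions (m, v) (n, w) =
    {f \<in> {1..m} \<rightarrow>\<^sub>E {1..n}.
      inj_on f {1..m} \<and> mono_on {1..m} f \<and> (\<forall>i\<in>{1..m}. w (f i) = v i)}"

definition Word :: "'l set \<Rightarrow> ('l word, nat \<Rightarrow> nat) cat" where
  "Word \<Sigma> = \<lparr>
    Ob = words \<Sigma>,
    Hom = subword_inclusions,
    Idn = (\<lambda>(n, w). restrict id {1..n}),
    Comp = (\<lambda>(m, _) _ _ g f. compose {1..m} g f)\<rparr>"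

definition full_subcategory :: "('o, 'm) cat \<Rightarrow> 'o set \<Rightarrow> ('o, 'm) cat" where
  "full_subcategory C S = C\<lparr>Ob := Ob C \<inter> S\<rparr>"

definition Sub :: "'l set \<Rightarrow> 'l word \<Rightarrow> ('l word, nat \<Rightarrow> nat) cat" where
  "Sub \<Sigma> w = full_subcategory (Word \<Sigma>) {v. Hom (Word \<Sigma>) v w \<noteq> {}}"

lemma category_Word: "category (Word \<Sigma>)"
proof (unfold_locales, goal_cases)
  case (1 x)
  then show ?case
    by (auto simp: Word_def words_def mono_on_def split: prod.splits)
next
  case (2 x y z f g)
  obtain k u m v n w where [simp]: "x = (k, u)" "y = (m, v)" "z = (n, w)"
    by (metis prod.exhaust)
  have f: "f \<in> {1..k} \<rightarrow>\<^sub>E {1..m}" "inj_on f {1..k}" "mono_on {1..k} f"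
      "\<And>i. i \<in> {1..k} \<Longrightarrow> v (f i) = u i"
    and g: "g \<in> {1..m} \<rightarrow>\<^sub>E {1..n}" "inj_on g {1..m}" "mono_on {1..m} g"
      "\<And>i. i \<in> {1..m} \<Longrightarrow> w (g i) = v i"
    using 2(4,5) by (auto simp: Word_def)
  have f_in: "f i \<in> {1..m}" if "i \<in> {1..k}" for i
    using f(1) that by (rule PiE_mem)
  have g_in: "g i \<in> {1..n}" if "i \<in> {1..m}" for i
    using g(1) that by (rule PiE_mem)
  have "compose {1..k} g f \<in> {1..k} \<rightarrow>\<^sub>E {1..n}"
    using f_in g_in by (auto simp: compose_def)
  moreover have "inj_on (compose {1..k} g f) {1..k}"
    using f(2) g(2) f_in by (intro inj_onI) (metis compose_eq inj_onD)
  moreover have "mono_on {1..k} (compose {1..k} g f)"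
    using f(3) g(3) f_in by (intro mono_onI) (metis compose_eq mono_onD)
  moreover have "\<forall>i\<in>{1..k}. w (compose {1..k} g f i) = u i"
    using f(4) g(4) f_in by (metis compose_eq)
  ultimately show ?case by (simp add: Word_def)
next
  case (3 x y f)
  then show ?case
    by (cases x; cases y)
      (auto simp: Word_def compose_def restrict_def fun_eq_iff PiE_def extensional_def)
next
  case (4 x y f)
  then show ?case
    by (cases x; cases y)
      (auto simp: Word_def compose_def restrict_def fun_eq_iff PiE_def Pi_def extensional_def)
next
  case (5 x y z u f g h)
  then show ?case
    by (cases x; cases y; cases z; cases u)
      (auto simp: Word_def compose_def restrict_def fun_eq_iff PiE_def Pi_def)
qed

lemma (in category) category_full_subcategory: "category (full_subcategory C S)"
  by unfold_locales
    (auto simp: full_subcategory_def Idn_in_Hom Comp_in_Hom Comp_Idn_right Comp_Idn_left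
      Comp_assoc)

lemma category_Sub: "category (Sub \<Sigma> w)"
  unfolding Sub_def by (rule category.category_full_subcategory[OF category_Word])


section \<open>Functors and weak word-embeddability\<close>

record ('o1, 'm1, 'o2, 'm2) cat_map =
  Fob :: "'o1 \<Rightarrow> 'o2"
  Fmor :: "'o1 \<Rightarrow> 'o1 \<Rightarrow> 'm1 \<Rightarrow> 'm2"

locale cat_functor = dom: category D + cod: category E
  for D :: "('o1, 'm1) cat" and E :: "('o2, 'm2) cat" +
  fixes F :: "('o1, 'm1, 'o2, 'm2) cat_map"
  assumes Fob_in: "x \<in> Ob D \<Longrightarrow> Fob F x \<in> Ob E"
    and Fmor_in:
      "\<lbrakk>x \<in> Ob D; y \<in> Ob D; f \<in> Hom D x y\<rbrakk>
        \<Longrightarrow> Fmor F x y f \<in> Hom E (Fob F x) (Fob F y)"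
    and Fmor_Idn: "x \<in> Ob D \<Longrightarrow> Fmor F x x (Idn D x) = Idn E (Fob F x)"
    and Fmor_Comp:
      "\<lbrakk>x \<in> Ob D; y \<in> Ob D; z \<in> Ob D; f \<in> Hom D x y; g \<in> Hom D y z\<rbrakk>
        \<Longrightarrow> Fmor F x z (Comp D x y z g f) =
          Comp E (Fob F x) (Fob F y) (Fob F z) (Fmor F y z g) (Fmor F x y f)"

definition faithful_functor :: "('o1, 'm1) cat \<Rightarrow> ('o1, 'm1, 'o2, 'm2) cat_map \<Rightarrow> bool" where
  "faithful_functor D F \<longleftrightarrow> (\<forall>x\<in>Ob D. \<forall>y\<in>Ob D. inj_on (Fmor F x y) (Hom D x y))"

definition weakly_word_embeddable_over :: "'l set \<Rightarrow> ('o, 'm) cat \<Rightarrow> bool" where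
  "weakly_word_embeddable_over \<Sigma> D \<longleftrightarrow>
    (\<exists>w\<in>words \<Sigma>. \<exists>F. cat_functor D (Sub \<Sigma> w) F \<and> faithful_functor D F \<and> inj_on (Fob F) (Ob D))"

text \<open>
  HOL cannot quantify existentially over the type of letters. Since words are finite,
  alphabets consisting of natural numbers suffice; the lemma
  \<open>weakly_word_embeddable_overD\<close> below shows that no alphabet is lost.
\<close>

definition weakly_word_embeddable :: "('o, 'm) cat \<Rightarrow> bool" where
  "weakly_word_embeddable D \<longleftrightarrow> (\<exists>\<Sigma> :: nat set. weakly_word_embeddable_over \<Sigma> D)"

lemma weakly_word_embeddable_overD:
  fixes \<Sigma> :: "'l set"
  assumes "weakly_word_embeddable_over \<Sigma> D"
  shows "weakly_word_embeddable D"
proof -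
  obtain w F where w: "w \<in> words \<Sigma>" and F: "cat_functor D (Sub \<Sigma> w) F"
    and faithful: "faithful_functor D F" and inj: "inj_on (Fob F) (Ob D)"
    using assms by (auto simp: weakly_word_embeddable_over_def)
  interpret F: cat_functor D "Sub \<Sigma> w" F by (fact F)
  obtain n a where na: "w = (n, a)" by (cases w)
  define A where "A = a ` {1..n}"
  have "countable A" by (simp add: A_def)
  then obtain s :: "'l \<Rightarrow> nat" where s: "inj_on s A" by (auto simp: countable_def)
  define R :: "'l word \<Rightarrow> nat word" where "R = (\<lambda>(m, v). (m, restrict (s \<circ> v) {1..m}))"
  have letters: "\<exists>m v. x = (m, v) \<and> v \<in> {1..m} \<rightarrow>\<^sub>E A" if x: "x \<in> Ob (Sub \<Sigma> w)" for x
  proof -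
    obtain m v where mv: "x = (m, v)" by (cases x)
    obtain f where f: "f \<in> {1..m} \<rightarrow>\<^sub>E {1..n}" "\<And>i. i \<in> {1..m} \<Longrightarrow> a (f i) = v i"
      using x by (auto simp: Sub_def full_subcategory_def Word_def mv na)
    have "v i \<in> A" if "i \<in> {1..m}" for i
      using f(2)[OF that] PiE_mem[OF f(1) that] by (metis A_def imageI)
    moreover have "v \<in> extensional {1..m}"
      using x by (auto simp: Sub_def full_subcategory_def Word_def words_def mv PiE_def)
    ultimately show ?thesis using mv by (auto simp: PiE_def)
  qed
  have R_inj: "inj_on R (Ob (Sub \<Sigma> w))"
  proof (rule inj_onI)
    fix x y assume x: "x \<in> Ob (Sub \<Sigma> w)" and y: "y \<in> Ob (Sub \<Sigma> w)" and eq: "R x = R y"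
    obtain m v where v: "x = (m, v)" "v \<in> {1..m} \<rightarrow>\<^sub>E A" using letters[OF x] by blast
    obtain k u where u: "y = (k, u)" "u \<in> {1..k} \<rightarrow>\<^sub>E A" using letters[OF y] by blast
    have mk: "k = m" and e: "restrict (s \<circ> v) {1..m} = restrict (s \<circ> u) {1..m}"
      using eq by (auto simp: R_def v u)
    have "v i = u i" if i: "i \<in> {1..m}" for i
    proof -
      have "s (v i) = s (u i)" using fun_cong[OF e, of i] i by simp
      then show ?thesis using inj_onD[OF s] v(2) u(2) i mk by (meson PiE_mem)
    qed
    then have "v = u" using v(2) u(2) mk by (intro PiE_ext) auto
    then show "x = y" by (simp add: v u mk)
  qed
  have R_Hom: "f \<in> Hom (Sub UNIV w') (R x) (R y)"
    if "f \<in> Hom (Sub \<Sigma> w) x y" for f x y w'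
    using that
    by (cases x; cases y) (auto simp: R_def Sub_def full_subcategory_def Word_def PiE_iff)
  have R_Ob: "R x \<in> Ob (Sub UNIV (R w))" if x: "x \<in> Ob (Sub \<Sigma> w)" for x
  proof -
    obtain f where f: "f \<in> Hom (Word \<Sigma>) x w"
      using x by (auto simp: Sub_def full_subcategory_def)
    have "f \<in> Hom (Sub \<Sigma> w) x w" using f by (simp add: Sub_def full_subcategory_def)
    then have "f \<in> Hom (Sub UNIV (R w)) (R x) (R w)" by (rule R_Hom)
    then have "Hom (Word UNIV) (R x) (R w) \<noteq> {}" by (auto simp: Sub_def full_subcategory_def)
    moreover have "R x \<in> words UNIV" by (cases x) (simp add: R_def words_def)
    ultimately show ?thesis by (simp add: Sub_def full_subcategory_def Word_def)
  qed
  have fst_R: "fst (R x) = fst x" for x by (cases x) (simp add: R_def)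
  have Idn_eq': "Idn (Sub \<Sigma>' v) x = restrict id {1..fst x}" for \<Sigma>' :: "nat set" and v x
    by (cases x) (simp add: Sub_def full_subcategory_def Word_def)
  have Comp_eq': "Comp (Sub \<Sigma>' v) x y z g f = compose {1..fst x} g f"
    for \<Sigma>' :: "nat set" and v x y z g f
    by (cases x) (simp add: Sub_def full_subcategory_def Word_def)
  have Idn_eq_l: "Idn (Sub \<Sigma> w) x = restrict id {1..fst x}" for x
    by (cases x) (simp add: Sub_def full_subcategory_def Word_def)
  have Comp_eq_l: "Comp (Sub \<Sigma> w) x y z g f = compose {1..fst x} g f" for x y z g f
    by (cases x) (simp add: Sub_def full_subcategory_def Word_def)
  define G where "G = \<lparr>Fob = R \<circ> Fob F, Fmor = Fmor F\<rparr>"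
  have "cat_functor D (Sub UNIV (R w)) G"
    by (intro cat_functor.intro cat_functor_axioms.intro F.dom.category_axioms category_Sub)
      (auto simp: G_def R_Ob F.Fob_in F.Fmor_Idn F.Fmor_Comp Idn_eq' Comp_eq' Idn_eq_l
        Comp_eq_l fst_R intro!: R_Hom F.Fmor_in)
  moreover have "faithful_functor D G"
    using faithful by (simp add: faithful_functor_def G_def)
  moreover have "inj_on (Fob G) (Ob D)"
    using inj R_inj F.Fob_in by (auto simp: G_def intro!: comp_inj_on elim: inj_on_subset)
  moreover have "R w \<in> words UNIV" by (cases w) (simp add: R_def words_def)
  ultimately show ?thesis
    by (auto simp: weakly_word_embeddable_def weakly_word_embeddable_over_def)
qed

end

theory Submission
  imports Defs "HOL-Library.Product_Lexorder"
begin

text \<open>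
  The four properties pass to slices and coslices by restricting the orders on the hom-sets.
  A category with these properties embeds by a Yoneda-type construction: an object \<open>d\<close>
  is sent to the word whose positions are the morphisms into \<open>d\<close>, sorted first by source and
  then by the given order on the hom-sets, each labelled by its source. Postcomposition with
  \<open>g\<close> preserves sources and strictly preserves the order, and it determines \<open>g\<close> as the
  image of the identity. By acyclicity the set of letters determines
  \<open>d\<close>. All these words are subwords of the word of all morphisms.
\<close>

section \<open>Words from finite keyed sets\<close>

text \<open>Counts from 1, since positions in a word do: the least element of \<open>A\<close> has
  itself below it.\<close>

definition pos :: "('a \<Rightarrow> 'k::linorder) \<Rightarrow> 'a set \<Rightarrow> 'a \<Rightarrow> nat" where
  "pos k A p = card {q \<in> A. k q \<le> k p}"

definition elt :: "('a \<Rightarrow> 'k::linorder) \<Rightarrow> 'a set \<Rightarrow> nat \<Rightarrow> 'a" where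
  "elt k A = the_inv_into A (pos k A)"

text \<open>The restricted lambda makes the word extensional, so that equal words are equal
  pairs.\<close>

definition word_of :: "('a \<Rightarrow> 'k::linorder) \<Rightarrow> ('a \<Rightarrow> 'l) \<Rightarrow> 'a set \<Rightarrow> 'l word" where
  "word_of k l A = (card A, \<lambda>i\<in>{1..card A}. l (elt k A i))"

text \<open>The map \<open>\<phi>\<close> conjugated by the two sortings, so that it acts on
  positions; restricted because subword inclusions are extensional.\<close>

definition incl :: "('a \<Rightarrow> 'k::linorder) \<Rightarrow> 'a set \<Rightarrow> 'a set \<Rightarrow> ('a \<Rightarrow> 'a) \<Rightarrow> nat \<Rightarrow> nat" where
  "incl k A B \<phi> = (\<lambda>i\<in>{1..card A}. pos k B (\<phi> (elt k A i)))"

section \<open>Ranks by key and their inverse\<close>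

lemma pos_less:
  assumes "finite A" "q \<in> A" "k p < k q"
  shows "pos k A p < pos k A q"
  unfolding pos_def
proof (rule psubset_card_mono)
  \<comment> \<open>The element \<open>q\<close> witnesses that the inclusion of lower sets is
    strict.\<close>
  have "q \<in> {r \<in> A. k r \<le> k q} - {r \<in> A. k r \<le> k p}" using assms by auto
  moreover have "{r \<in> A. k r \<le> k p} \<subseteq> {r \<in> A. k r \<le> k q}" using assms by auto
  ultimately show "{r \<in> A. k r \<le> k p} \<subset> {r \<in> A. k r \<le> k q}" by blast
qed (use assms in simp)

lemma pos_less_iff:
  assumes "finite A" "p \<in> A" "q \<in> A"
  shows "pos k A p < pos k A q \<longleftrightarrow> k p < k q"
proof
  assume "pos k A p < pos k A q"
  then show "k p < k q"
    using assms pos_less[of A p k q] by (cases "k p" "k q" rule: linorder_cases) (auto simp: pos_def)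
qed (rule pos_less[OF assms(1,3)])

text \<open>Injective keys give distinct ranks; \<open>card A\<close> distinct values in
  \<open>{1..card A}\<close> exhaust it.\<close>

lemma bij_betw_pos:
  assumes fin: "finite A" and inj: "inj_on k A"
  shows "bij_betw (pos k A) A {1..card A}"
proof -
  have inj_pos: "inj_on (pos k A) A"
  proof (rule inj_onI)
    fix p q assume "p \<in> A" "q \<in> A" "pos k A p = pos k A q"
    then have "k p = k q"
      using pos_less_iff[OF fin] by (metis linorder_neq_iff)
    then show "p = q" using inj \<open>p \<in> A\<close> \<open>q \<in> A\<close> by (simp add: inj_on_eq_iff)
  qed
  have "pos k A ` A \<subseteq> {1..card A}"
  proof (rule image_subsetI)
    fix p assume "p \<in> A"
    then have "{q \<in> A. k q \<le> k p} \<noteq> {}" by auto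
    then have "0 < pos k A p" using fin by (simp add: pos_def card_gt_0_iff)
    moreover have "pos k A p \<le> card A" unfolding pos_def using fin by (intro card_mono) auto
    ultimately show "pos k A p \<in> {1..card A}" by simp
  qed
  then have "pos k A ` A = {1..card A}"
    by (intro card_subset_eq) (simp_all add: card_image[OF inj_pos])
  with inj_pos show ?thesis by (simp add: bij_betw_def)
qed

lemma bij_betw_elt:
  assumes "finite A" "inj_on k A"
  shows "bij_betw (elt k A) {1..card A} A"
  unfolding elt_def by (rule bij_betw_the_inv_into[OF bij_betw_pos[OF assms]])

lemma pos_in:
  assumes "finite A" "inj_on k A" "p \<in> A"
  shows "pos k A p \<in> {1..card A}"
  using bij_betwE[OF bij_betw_pos[OF assms(1,2)]] assms(3) by blast

lemma elt_in:
  assumes "finite A" "inj_on k A" "i \<in> {1..card A}"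
  shows "elt k A i \<in> A"
  using bij_betwE[OF bij_betw_elt[OF assms(1,2)]] assms(3) by blast

lemma elt_pos [simp]:
  assumes "finite A" "inj_on k A" "p \<in> A"
  shows "elt k A (pos k A p) = p"
  unfolding elt_def using bij_betw_pos[OF assms(1,2)] assms(3)
  by (simp add: bij_betw_def the_inv_into_f_f)

lemma pos_elt [simp]:
  assumes "finite A" "inj_on k A" "i \<in> {1..card A}"
  shows "pos k A (elt k A i) = i"
  unfolding elt_def using f_the_inv_into_f_bij_betw[OF bij_betw_pos[OF assms(1,2)]] assms(3)
  by blast

section \<open>Words and subword inclusions from keyed sets\<close>

lemma word_of_in_words: "finite A \<Longrightarrow> inj_on k A \<Longrightarrow> l ` A \<subseteq> \<Sigma> \<Longrightarrow> word_of k l A \<in> words \<Sigma>"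
  using elt_in[of A k] by (auto simp: word_of_def words_def)

text \<open>Recovers the labels from the word alone; this is what later separates objects.\<close>

lemma letters_word_of:
  assumes "finite A" "inj_on k A"
  shows "snd (word_of k l A) ` {1..fst (word_of k l A)} = l ` A"
proof -
  have "snd (word_of k l A) ` {1..fst (word_of k l A)} = l ` elt k A ` {1..card A}"
    by (force simp: word_of_def)
  then show ?thesis using bij_betw_elt[OF assms] by (simp add: bij_betw_def)
qed

text \<open>Comparing positions amounts to comparing keys, so a strictly key-preserving map is
  strictly increasing on positions. This gives injectivity and monotonicity at once; preservation of
  labels gives the condition on letters.\<close>

lemma incl_in_subword_inclusions:
  assumes A: "finite A" "inj_on k A" and B: "finite B" "inj_on k B"
    and \<phi>: "\<phi> \<in> A \<rightarrow> B"
    and mono: "\<And>p q. p \<in> A \<Longrightarrow> q \<in> A \<Longrightarrow> k p < k q \<Longrightarrow> k (\<phi> p) < k (\<phi> q)"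
    and l: "\<And>p. p \<in> A \<Longrightarrow> l (\<phi> p) = l p"
  shows "incl k A B \<phi> \<in> subword_inclusions (word_of k l A) (word_of k l B)"
proof -
  have \<phi>_elt: "\<phi> (elt k A i) \<in> B" if "i \<in> {1..card A}" for i
    using \<phi> elt_in[OF A that] by blast
  have strict: "incl k A B \<phi> i < incl k A B \<phi> j"
    if ij: "i \<in> {1..card A}" "j \<in> {1..card A}" "i < j" for i j
  proof -
    have "pos k A (elt k A i) < pos k A (elt k A j)" using ij A by simp
    then have "k (elt k A i) < k (elt k A j)"
      using pos_less_iff[OF A(1)] elt_in[OF A] ij by blast
    then have "k (\<phi> (elt k A i)) < k (\<phi> (elt k A j))"
      using mono elt_in[OF A] ij by blast
    from pos_less[OF B(1) \<phi>_elt[OF ij(2)] this] show ?thesis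
      using ij by (simp add: incl_def)
  qed
  have in_B: "incl k A B \<phi> i \<in> {1..card B}" if "i \<in> {1..card A}" for i
    using pos_in[OF B \<phi>_elt[OF that]] that by (simp add: incl_def)
  have "incl k A B \<phi> \<in> {1..card A} \<rightarrow>\<^sub>E {1..card B}"
    using in_B by (auto simp: incl_def)
  moreover have "inj_on (incl k A B \<phi>) {1..card A}"
    by (rule linorder_inj_onI) (use strict in \<open>force+\<close>)
  moreover have "mono_on {1..card A} (incl k A B \<phi>)"
    using strict by (intro mono_onI) (metis le_less)
  moreover have "snd (word_of k l B) (incl k A B \<phi> i) = snd (word_of k l A) i"
    if i: "i \<in> {1..card A}" for i
  proof -
    have "elt k B (incl k A B \<phi> i) = \<phi> (elt k A i)"
      using i \<phi>_elt[OF i] B by (simp add: incl_def)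
    then show ?thesis
      using in_B[OF i] i l[OF elt_in[OF A i]] by (simp add: word_of_def)
  qed
  ultimately show ?thesis by (simp add: word_of_def)
qed

lemma incl_ident:
  assumes "finite A" "inj_on k A" "\<And>p. p \<in> A \<Longrightarrow> \<phi> p = p"
  shows "incl k A A \<phi> = restrict id {1..card A}"
  unfolding incl_def
  by (rule restrict_ext) (simp add: assms elt_in)

text \<open>In the composite, \<open>elt k B\<close> meets \<open>pos k B\<close> and the two
  cancel.\<close>

lemma incl_comp:
  assumes A: "finite A" "inj_on k A" and B: "finite B" "inj_on k B"
    and \<phi>: "\<phi> \<in> A \<rightarrow> B" and \<chi>: "\<And>p. p \<in> A \<Longrightarrow> \<chi> p = \<psi> (\<phi> p)"
  shows "incl k A C \<chi> = compose {1..card A} (incl k B C \<psi>) (incl k A B \<phi>)"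
proof
  fix i
  show "incl k A C \<chi> i = compose {1..card A} (incl k B C \<psi>) (incl k A B \<phi>) i"
  proof (cases "i \<in> {1..card A}")
    case True
    then have e: "elt k A i \<in> A" by (rule elt_in[OF A])
    then have "\<phi> (elt k A i) \<in> B" using \<phi> by blast
    then show ?thesis
      using True e B pos_in[OF B, of "\<phi> (elt k A i)"] by (simp add: incl_def compose_eq \<chi>)
  next
    \<comment> \<open>Outside the positions both sides are \<open>undefined\<close>.\<close>
    case False
    then show ?thesis unfolding incl_def compose_def by (simp only: restrict_apply if_False)
  qed
qed

text \<open>Evaluate both maps at the position of \<open>p\<close>, then undo \<open>pos k B\<close>
  by \<open>elt k B\<close>.\<close>

lemma incl_eqD:
  assumes A: "finite A" "inj_on k A" and B: "finite B" "inj_on k B"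
    and maps: "\<phi> \<in> A \<rightarrow> B" "\<psi> \<in> A \<rightarrow> B" and eq: "incl k A B \<phi> = incl k A B \<psi>" and p: "p \<in> A"
  shows "\<phi> p = \<psi> p"
proof -
  have "pos k B (\<phi> p) = pos k B (\<psi> p)"
    using fun_cong[OF eq, of "pos k A p"] p A pos_in[OF A p] by (simp add: incl_def)
  moreover have "\<phi> p \<in> B" "\<psi> p \<in> B" using maps p by auto
  ultimately show ?thesis by (metis elt_pos[OF B])
qed


section \<open>The embedding\<close>

text \<open>Morphisms are kept as triples since the hom-sets may overlap; \<open>fst\<close> then
  reads off the source.\<close>

definition mors_into :: "('o, 'm) cat \<Rightarrow> 'o \<Rightarrow> ('o \<times> 'o \<times> 'm) set" where
  "mors_into C d = {(x, y, f) \<in> Mor C. y = d}"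

text \<open>The covariant action of \<open>g\<close> on all morphisms into its source, as in the
  Yoneda embedding.\<close>

definition postcomp :: "('o, 'm) cat \<Rightarrow> 'o \<Rightarrow> 'm \<Rightarrow> 'o \<times> 'o \<times> 'm \<Rightarrow> 'o \<times> 'o \<times> 'm" where
  "postcomp C e g = (\<lambda>(x, d, f). (x, e, Comp C x d e g f))"

lemma (in category) postcomp_in_mors_into:
  "d \<in> Ob C \<Longrightarrow> e \<in> Ob C \<Longrightarrow> g \<in> Hom C d e \<Longrightarrow> postcomp C e g \<in> mors_into C d \<rightarrow> mors_into C e"
  by (auto simp: mors_into_def Mor_def postcomp_def Comp_in_Hom)

text \<open>One key sorts all morphisms, so the word of each object and the ambient word are sorted
  consistently. Monotonicity of the key under postcomposition is asked only for morphisms with a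
  common target.\<close>

lemma weakly_word_embeddable_if_keyed:
  fixes D :: "('o, 'm) cat" and k :: "'o \<times> 'o \<times> 'm \<Rightarrow> 'k::linorder"
  assumes finD: "finite_category D" and acyD: "acyclic_category D"
    and inj: "inj_on k (Mor D)"
    and mono: "\<And>d e g p q. \<lbrakk>d \<in> Ob D; e \<in> Ob D; g \<in> Hom D d e; p \<in> mors_into D d;
      q \<in> mors_into D d; k p < k q\<rbrakk> \<Longrightarrow> k (postcomp D e g p) < k (postcomp D e g q)"
  shows "weakly_word_embeddable D"
proof -
  interpret finite_category D by fact
  interpret acyclic_category D by fact
  let ?M = "mors_into D"
  define w where "w = word_of k fst (Mor D)"
  define F where "F = \<lparr>Fob = (\<lambda>d. word_of k fst (?M d)),
    Fmor = (\<lambda>d e g. incl k (?M d) (?M e) (postcomp D e g))\<rparr>"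
  have sub: "?M d \<subseteq> Mor D" for d by (auto simp: mors_into_def)
  have M: "finite (?M d)" "inj_on k (?M d)" for d
    using finite_subset[OF sub finite_Mor] inj_on_subset[OF inj sub] by auto
  note Mor = finite_Mor inj
  have w: "w \<in> words (Ob D)"
    unfolding w_def by (rule word_of_in_words[OF Mor]) (auto simp: Mor_def)
  have Fob: "word_of k fst (?M d) \<in> Ob (Sub (Ob D) w)" if d: "d \<in> Ob D" for d
  proof -
    have "word_of k fst (?M d) \<in> words (Ob D)"
      by (rule word_of_in_words[OF M]) (auto simp: mors_into_def Mor_def)
    \<comment> \<open>The inclusion of \<open>?M d\<close> into \<open>Mor D\<close> changes neither
      keys nor sources, so it induces a subword inclusion into \<open>w\<close>.\<close>
    moreover have "incl k (?M d) (Mor D) id \<in> subword_inclusions (word_of k fst (?M d)) w"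
      unfolding w_def by (rule incl_in_subword_inclusions[OF M Mor]) (use sub[of d] in auto)
    ultimately show ?thesis by (auto simp: Sub_def full_subcategory_def Word_def)
  qed
  have Fmor: "incl k (?M d) (?M e) (postcomp D e g)
      \<in> subword_inclusions (word_of k fst (?M d)) (word_of k fst (?M e))"
    if "d \<in> Ob D" "e \<in> Ob D" "g \<in> Hom D d e" for d e g
    using that mono
    by (intro incl_in_subword_inclusions M postcomp_in_mors_into)
      (auto simp: postcomp_def split: prod.splits)
  have "cat_functor D (Sub (Ob D) w) F"
  proof (intro cat_functor.intro cat_functor_axioms.intro category_axioms category_Sub)
    fix x assume x: "x \<in> Ob D"
    show "Fob F x \<in> Ob (Sub (Ob D) w)" using Fob[OF x] by (simp add: F_def)
    have "incl k (?M x) (?M x) (postcomp D x (Idn D x)) = restrict id {1..card (?M x)}"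
      by (rule incl_ident[OF M]) (auto simp: mors_into_def Mor_def postcomp_def Comp_Idn_left)
    then show "Fmor F x x (Idn D x) = Idn (Sub (Ob D) w) (Fob F x)"
      by (simp add: F_def Sub_def full_subcategory_def Word_def word_of_def)
  next
    fix x y f assume "x \<in> Ob D" "y \<in> Ob D" "f \<in> Hom D x y"
    then show "Fmor F x y f \<in> Hom (Sub (Ob D) w) (Fob F x) (Fob F y)"
      using Fmor by (simp add: F_def Sub_def full_subcategory_def Word_def)
  next
    fix x y z f g
    assume a: "x \<in> Ob D" "y \<in> Ob D" "z \<in> Ob D" "f \<in> Hom D x y" "g \<in> Hom D y z"
    have "incl k (?M x) (?M z) (postcomp D z (Comp D x y z g f)) =
        compose {1..card (?M x)} (incl k (?M y) (?M z) (postcomp D z g))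
          (incl k (?M x) (?M y) (postcomp D y f))"
      \<comment> \<open>Functoriality is associativity: postcomposing with a composite is
        postcomposing twice.\<close>
      by (rule incl_comp[OF M M postcomp_in_mors_into[OF a(1,2,4)]])
        (use a in \<open>auto simp: mors_into_def Mor_def postcomp_def Comp_assoc\<close>)
    then show "Fmor F x z (Comp D x y z g f) =
        Comp (Sub (Ob D) w) (Fob F x) (Fob F y) (Fob F z) (Fmor F y z g) (Fmor F x y f)"
      by (simp add: F_def Sub_def full_subcategory_def Word_def word_of_def)
  qed
  moreover have "faithful_functor D F"
    unfolding faithful_functor_def
  proof (intro ballI inj_onI)
    fix x y f g
    assume a: "x \<in> Ob D" "y \<in> Ob D" "f \<in> Hom D x y" "g \<in> Hom D x y"
      and eq: "Fmor F x y f = Fmor F x y g"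
    \<comment> \<open>Yoneda argument: the image of the identity under postcomposition is the
      morphism itself.\<close>
    have ident: "(x, x, Idn D x) \<in> ?M x" using a by (simp add: mors_into_def Mor_def Idn_in_Hom)
    have "incl k (?M x) (?M y) (postcomp D y f) = incl k (?M x) (?M y) (postcomp D y g)"
      using eq by (simp add: F_def)
    then have "postcomp D y f (x, x, Idn D x) = postcomp D y g (x, x, Idn D x)"
      by (rule incl_eqD[OF M M postcomp_in_mors_into[OF a(1,2,3)]
            postcomp_in_mors_into[OF a(1,2,4)] _ ident])
    then show "f = g" using a by (simp add: postcomp_def Comp_Idn_right)
  qed
  moreover have "inj_on (Fob F) (Ob D)"
  proof (rule inj_onI, rule ccontr)
    fix d e assume a: "d \<in> Ob D" "e \<in> Ob D" "Fob F d = Fob F e" "d \<noteq> e"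
    have "word_of k fst (?M d) = word_of k fst (?M e)" using a(3) by (simp add: F_def)
    \<comment> \<open>The letters of the word of an object are the sources of its incoming
      morphisms, and the identity puts the object itself among them. So \<open>d\<close> and
      \<open>e\<close> receive morphisms from each other, against acyclicity.\<close>
    then have "fst ` ?M d = fst ` ?M e"
      using letters_word_of[OF M, of fst d] letters_word_of[OF M, of fst e] by simp
    moreover have "x \<in> fst ` ?M x" if "x \<in> Ob D" for x
      by (rule image_eqI[of _ _ "(x, x, Idn D x)"])
        (simp_all add: that mors_into_def Mor_def Idn_in_Hom)
    note this[OF a(1)] this[OF a(2)]
    ultimately have "d \<in> fst ` ?M e" "e \<in> fst ` ?M d" by auto
    then have "Hom D d e \<noteq> {}" "Hom D e d \<noteq> {}" by (auto simp: mors_into_def Mor_def)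
    then show False using no_cycles a by blast
  qed
  ultimately have "weakly_word_embeddable_over (Ob D) D"
    unfolding weakly_word_embeddable_over_def using w by blast
  then show ?thesis by (rule weakly_word_embeddable_overD)
qed

text \<open>Transitivity nests the two lower sets, and \<open>b\<close> lies only in the larger one.
  This turns an order given as a relation into numbers, which can serve in a key of class
  \<open>linorder\<close>.\<close>

lemma linear_order_rank_less:
  assumes "finite A" "linear_order_on A r" "a \<in> A" "b \<in> A" "(a, b) \<in> r" "a \<noteq> b"
  shows "card {x \<in> A. (x, a) \<in> r} < card {x \<in> A. (x, b) \<in> r}"
proof (rule psubset_card_mono)
  have "(b, a) \<notin> r" "(b, b) \<in> r" "trans r"
    using assms unfolding linear_order_on_def partial_order_on_def preorder_on_def
    by (auto dest: antisymD refl_onD)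
  then show "{x \<in> A. (x, a) \<in> r} \<subset> {x \<in> A. (x, b) \<in> r}"
    using assms by (auto dest: transD)
qed (use assms in simp)

text \<open>The key is a lexicographic triple with the source first. Postcomposition fixes sources,
  so the compatible orders are needed only to compare parallel morphisms.\<close>

theorem weakly_word_embeddable_if_left_locally_totally_ordered:
  fixes D :: "('o, 'm) cat"
  assumes finD: "finite_category D" and acyD: "acyclic_category D"
    and ordD: "left_locally_totally_ordered_category D"
  shows "weakly_word_embeddable D"
proof -
  interpret finite_category D by fact
  interpret left_locally_totally_ordered_category D by fact
  obtain r :: "'o \<Rightarrow> 'o \<Rightarrow> ('m \<times> 'm) set" where
    lin: "\<And>c d. c \<in> Ob D \<Longrightarrow> d \<in> Ob D \<Longrightarrow> linear_order_on (Hom D c d) (r c d)"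
    and comp: "\<And>c d e g f1 f2. \<lbrakk>c \<in> Ob D; d \<in> Ob D; e \<in> Ob D; g \<in> Hom D d e;
        f1 \<in> Hom D c d; f2 \<in> Hom D c d; (f1, f2) \<in> r c d; f1 \<noteq> f2\<rbrakk> \<Longrightarrow>
        (Comp D c d e g f1, Comp D c d e g f2) \<in> r c e \<and>
        Comp D c d e g f1 \<noteq> Comp D c d e g f2"
    using ex_left_compatible_order by metis
  \<comment> \<open>An arbitrary numbering of the finitely many objects; its order carries no
    meaning.\<close>
  obtain \<iota> :: "'o \<Rightarrow> nat" where \<iota>: "inj_on \<iota> (Ob D)"
    using finite_imp_inj_to_nat_seg[OF finite_Ob] by blast
  define \<rho> where "\<rho> x d f = card {f' \<in> Hom D x d. (f', f) \<in> r x d}" for x d f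
  \<comment> \<open>The target component matters only in the word of all morphisms.\<close>
  define k where "k = (\<lambda>(x, d, f). (\<iota> x, \<iota> d, \<rho> x d f))"
  have finHom: "finite (Hom D x y)" if "x \<in> Ob D" "y \<in> Ob D" for x y
    by (rule finite_surj[OF finite_Mor, of _ "snd \<circ> snd"]) (use that in \<open>force simp: Mor_def\<close>)
  have \<rho>_less: "\<rho> x d f < \<rho> x d f'"
    if "x \<in> Ob D" "d \<in> Ob D" "f \<in> Hom D x d" "f' \<in> Hom D x d" "(f, f') \<in> r x d" "f \<noteq> f'"
    for x d f f'
    unfolding \<rho>_def using that by (intro linear_order_rank_less finHom lin)
  have total: "(f, f') \<in> r x d \<or> (f', f) \<in> r x d"
    if "x \<in> Ob D" "d \<in> Ob D" "f \<in> Hom D x d" "f' \<in> Hom D x d" "f \<noteq> f'" for x d f f'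
    using lin[OF that(1,2)] that by (auto simp: linear_order_on_def total_on_def)
  have inj_\<rho>: "f = f'"
    if "x \<in> Ob D" "d \<in> Ob D" "f \<in> Hom D x d" "f' \<in> Hom D x d" "\<rho> x d f = \<rho> x d f'" for x d f f'
    using that total \<rho>_less by (metis less_irrefl)
  show ?thesis
  proof (rule weakly_word_embeddable_if_keyed[OF finD acyD])
    show "inj_on k (Mor D)"
      by (rule inj_onI) (auto simp: k_def Mor_def inj_on_eq_iff[OF \<iota>] inj_\<rho>)
  next
    fix d e g p q
    assume a: "d \<in> Ob D" "e \<in> Ob D" "g \<in> Hom D d e"
      and p: "p \<in> mors_into D d" and q: "q \<in> mors_into D d" and less: "k p < k q"
    obtain x f where p_eq: "p = (x, d, f)" and x: "x \<in> Ob D" "f \<in> Hom D x d"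
      using p by (auto simp: mors_into_def Mor_def)
    obtain y f' where q_eq: "q = (y, d, f')" and y: "y \<in> Ob D" "f' \<in> Hom D y d"
      using q by (auto simp: mors_into_def Mor_def)
    show "k (postcomp D e g p) < k (postcomp D e g q)"
    proof (cases "x = y")
      case True
      have "\<rho> x d f < \<rho> x d f'" using less True by (simp add: p_eq q_eq k_def)
      \<comment> \<open>Ranks reflect the order: were \<open>f'\<close> strictly below
        \<open>f\<close>, its rank would be smaller. Totality then leaves \<open>f\<close> below
        \<open>f'\<close>.\<close>
      then have "f \<noteq> f'" "(f', f) \<notin> r x d"
        using \<rho>_less[of x d f' f] a x y True by auto
      then have "(f, f') \<in> r x d" using total[of x d f f'] a x y True by blast
      then have "\<rho> x e (Comp D x d e g f) < \<rho> x e (Comp D x d e g f')"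
        using a x y True \<open>f \<noteq> f'\<close> comp by (intro \<rho>_less Comp_in_Hom) blast+
      then show ?thesis by (simp add: p_eq q_eq k_def postcomp_def True)
    next
      case False
      \<comment> \<open>Distinct sources decide the comparison in the first component, which
        postcomposition does not change.\<close>
      then have "\<iota> x \<noteq> \<iota> y" using \<iota> x y by (simp add: inj_on_eq_iff)
      then show ?thesis using less by (auto simp: p_eq q_eq k_def postcomp_def)
    qed
  qed
qed


section \<open>Slices and coslices\<close>

lemma finite_category_slice:
  assumes "finite_category C" "c \<in> Ob C"
  shows "finite_category (slice C c)"
proof -
  interpret finite_category C by fact
  \<comment> \<open>With \<open>c\<close> as fixed target, an object of the slice amounts to a
    morphism of \<open>C\<close>.\<close>
  have "Ob (slice C c) \<subseteq> (\<lambda>(x, y, f). (x, f)) ` Mor C"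
    using assms(2) by (force simp: slice_def Mor_def)
  then have fin: "finite (Ob (slice C c))"
    using finite_Mor finite_surj by blast
  have "Mor (slice C c) \<subseteq>
      Ob (slice C c) \<times> Ob (slice C c) \<times> (\<lambda>(x, y, f). f) ` Mor C"
    by (force simp: slice_def Mor_def)
  then have "finite (Mor (slice C c))"
    by (rule finite_subset) (intro finite_cartesian_product fin finite_imageI finite_Mor)
  with fin category_slice[OF assms(2)] show ?thesis
    by (intro finite_category.intro finite_category_axioms.intro)
qed

lemma finite_category_coslice:
  assumes "finite_category C" "c \<in> Ob C"
  shows "finite_category (coslice C c)"
proof -
  interpret finite_category C by fact
  have "Ob (coslice C c) \<subseteq> (\<lambda>(x, y, f). (y, f)) ` Mor C"
    using assms(2) by (force simp: coslice_def Mor_def)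
  then have fin: "finite (Ob (coslice C c))"
    using finite_Mor finite_surj by blast
  have "Mor (coslice C c) \<subseteq>
      Ob (coslice C c) \<times> Ob (coslice C c) \<times> (\<lambda>(x, y, f). f) ` Mor C"
    by (force simp: coslice_def Mor_def)
  then have "finite (Mor (coslice C c))"
    by (rule finite_subset) (intro finite_cartesian_product fin finite_imageI finite_Mor)
  with fin category_coslice[OF assms(2)] show ?thesis
    by (intro finite_category.intro finite_category_axioms.intro)
qed

lemma acyclic_category_slice:
  assumes "acyclic_category C" "c \<in> Ob C"
  shows "acyclic_category (slice C c)"
proof -
  interpret acyclic_category C by fact
  have "Hom (slice C c) q p = {}"
    if pq: "p \<in> Ob (slice C c)" "q \<in> Ob (slice C c)" "p \<noteq> q" "Hom (slice C c) p q \<noteq> {}" for p q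
  proof -
    obtain x f y g where [simp]: "p = (x, f)" "q = (y, g)" by (metis prod.exhaust)
    \<comment> \<open>If \<open>x = y\<close>, the only available morphism is the identity, and its
      triangle forces \<open>f = g\<close>, hence \<open>p = q\<close>.\<close>
    have "x \<noteq> y"
      using pq no_endomorphisms[of x] by (auto simp: slice_def Comp_Idn_right assms(2))
    then show ?thesis using pq no_cycles[of x y] by (auto simp: slice_def)
  qed
  moreover have "Hom (slice C c) p p = {Idn (slice C c) p}" if "p \<in> Ob (slice C c)" for p
    using that no_endomorphisms by (auto simp: slice_def Comp_Idn_right assms(2))
  ultimately show ?thesis
    by (intro acyclic_category.intro acyclic_category_axioms.intro category_slice assms(2))
qed

lemma acyclic_category_coslice:
  assumes "acyclic_category C" "c \<in> Ob C"
  shows "acyclic_category (coslice C c)"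
proof -
  interpret acyclic_category C by fact
  have "Hom (coslice C c) q p = {}"
    if pq: "p \<in> Ob (coslice C c)" "q \<in> Ob (coslice C c)" "p \<noteq> q" "Hom (coslice C c) p q \<noteq> {}"
    for p q
  proof -
    obtain x f y g where [simp]: "p = (x, f)" "q = (y, g)" by (metis prod.exhaust)
    have "x \<noteq> y"
      using pq no_endomorphisms[of x] by (auto simp: coslice_def Comp_Idn_left assms(2))
    then show ?thesis using pq no_cycles[of x y] by (auto simp: coslice_def)
  qed
  moreover have "Hom (coslice C c) p p = {Idn (coslice C c) p}" if "p \<in> Ob (coslice C c)" for p
    using that no_endomorphisms by (auto simp: coslice_def Comp_Idn_left assms(2))
  ultimately show ?thesis
    by (intro acyclic_category.intro acyclic_category_axioms.intro category_coslice assms(2))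
qed

text \<open>Composition is that of \<open>C\<close> on smaller hom-sets, so left cancellation is
  inherited.\<close>

lemma monic_category_slice:
  assumes "monic_category C" "c \<in> Ob C"
  shows "monic_category (slice C c)"
proof -
  interpret monic_category C by fact
  show ?thesis
    using all_mono
    by (intro monic_category.intro monic_category_axioms.intro category_slice assms(2))
      (fastforce simp: slice_def monomorphism_def)
qed

lemma monic_category_coslice:
  assumes "monic_category C" "c \<in> Ob C"
  shows "monic_category (coslice C c)"
proof -
  interpret monic_category C by fact
  show ?thesis
    using all_mono
    by (intro monic_category.intro monic_category_axioms.intro category_coslice assms(2))
      (fastforce simp: coslice_def monomorphism_def)
qed

section \<open>Orders on the hom-sets of slices and coslices\<close>

lemma linear_order_on_Restr:
  assumes "linear_order_on A r" "B \<subseteq> A"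
  shows "linear_order_on B (Restr r B)"
  using assms
  unfolding linear_order_on_def partial_order_on_def preorder_on_def
  by (auto simp: refl_on_def antisym_def total_on_def subset_iff intro: trans_Restr)

lemma left_locally_totally_ordered_category_slice:
  assumes "left_locally_totally_ordered_category C" "c \<in> Ob C"
  shows "left_locally_totally_ordered_category (slice C c)"
proof -
  interpret left_locally_totally_ordered_category C by fact
  let ?S = "slice C c"
  obtain r :: "'a \<Rightarrow> 'a \<Rightarrow> ('b \<times> 'b) set" where
    lin: "\<And>c d. c \<in> Ob C \<Longrightarrow> d \<in> Ob C \<Longrightarrow> linear_order_on (Hom C c d) (r c d)"
    and comp: "\<And>c d e g f1 f2. \<lbrakk>c \<in> Ob C; d \<in> Ob C; e \<in> Ob C; g \<in> Hom C d e;
        f1 \<in> Hom C c d; f2 \<in> Hom C c d; (f1, f2) \<in> r c d; f1 \<noteq> f2\<rbrakk> \<Longrightarrow>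
        (Comp C c d e g f1, Comp C c d e g f2) \<in> r c e \<and>
        Comp C c d e g f1 \<noteq> Comp C c d e g f2"
    using ex_left_compatible_order by metis
  interpret S: category ?S by (rule category_slice) fact
  \<comment> \<open>A hom-set of the slice is a subset of the hom-set between the underlying objects
    and takes its order from there.\<close>
  define s where "s p q = Restr (r (fst p) (fst q)) (Hom ?S p q)" for p q
  have "linear_order_on (Hom ?S p q) (s p q)" if "p \<in> Ob ?S" "q \<in> Ob ?S" for p q
    unfolding s_def
    by (rule linear_order_on_Restr[OF lin]) (use that in \<open>auto simp: slice_def\<close>)
  moreover have "(Comp ?S p q u g f1, Comp ?S p q u g f2) \<in> s p u \<and>
      Comp ?S p q u g f1 \<noteq> Comp ?S p q u g f2"
    if a: "p \<in> Ob ?S" "q \<in> Ob ?S" "u \<in> Ob ?S" "g \<in> Hom ?S q u" "f1 \<in> Hom ?S p q"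
      "f2 \<in> Hom ?S p q" "(f1, f2) \<in> s p q" "f1 \<noteq> f2" for p q u g f1 f2
  proof -
    have "(Comp ?S p q u g f1, Comp ?S p q u g f2) \<in> r (fst p) (fst u) \<and>
        Comp ?S p q u g f1 \<noteq> Comp ?S p q u g f2"
      using a comp[of "fst p" "fst q" "fst u" g f1 f2] by (auto simp: s_def slice_def)
    \<comment> \<open>Closure of the slice under composition brings the compared composites back
      into the restricted relation.\<close>
    then show ?thesis using a S.Comp_in_Hom by (auto simp: s_def)
  qed
  ultimately show ?thesis
    by (intro left_locally_totally_ordered_category.intro
        left_locally_totally_ordered_category_axioms.intro S.category_axioms exI[of _ s]) blast
qed

lemma left_locally_totally_ordered_category_coslice:
  assumes "left_locally_totally_ordered_category C" "c \<in> Ob C"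
  shows "left_locally_totally_ordered_category (coslice C c)"
proof -
  interpret left_locally_totally_ordered_category C by fact
  let ?S = "coslice C c"
  obtain r :: "'a \<Rightarrow> 'a \<Rightarrow> ('b \<times> 'b) set" where
    lin: "\<And>c d. c \<in> Ob C \<Longrightarrow> d \<in> Ob C \<Longrightarrow> linear_order_on (Hom C c d) (r c d)"
    and comp: "\<And>c d e g f1 f2. \<lbrakk>c \<in> Ob C; d \<in> Ob C; e \<in> Ob C; g \<in> Hom C d e;
        f1 \<in> Hom C c d; f2 \<in> Hom C c d; (f1, f2) \<in> r c d; f1 \<noteq> f2\<rbrakk> \<Longrightarrow>
        (Comp C c d e g f1, Comp C c d e g f2) \<in> r c e \<and>
        Comp C c d e g f1 \<noteq> Comp C c d e g f2"
    using ex_left_compatible_order by metis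
  interpret S: category ?S by (rule category_coslice) fact
  define s where "s p q = Restr (r (fst p) (fst q)) (Hom ?S p q)" for p q
  have "linear_order_on (Hom ?S p q) (s p q)" if "p \<in> Ob ?S" "q \<in> Ob ?S" for p q
    unfolding s_def
    by (rule linear_order_on_Restr[OF lin]) (use that in \<open>auto simp: coslice_def\<close>)
  moreover have "(Comp ?S p q u g f1, Comp ?S p q u g f2) \<in> s p u \<and>
      Comp ?S p q u g f1 \<noteq> Comp ?S p q u g f2"
    if a: "p \<in> Ob ?S" "q \<in> Ob ?S" "u \<in> Ob ?S" "g \<in> Hom ?S q u" "f1 \<in> Hom ?S p q"
      "f2 \<in> Hom ?S p q" "(f1, f2) \<in> s p q" "f1 \<noteq> f2" for p q u g f1 f2
  proof -
    have "(Comp ?S p q u g f1, Comp ?S p q u g f2) \<in> r (fst p) (fst u) \<and>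
        Comp ?S p q u g f1 \<noteq> Comp ?S p q u g f2"
      using a comp[of "fst p" "fst q" "fst u" g f1 f2] by (auto simp: s_def coslice_def)
    then show ?thesis using a S.Comp_in_Hom by (auto simp: s_def)
  qed
  ultimately show ?thesis
    by (intro left_locally_totally_ordered_category.intro
        left_locally_totally_ordered_category_axioms.intro S.category_axioms exI[of _ s]) blast
qed

theorem proposition5p18:
  fixes C :: "('o, 'm) cat" and c :: 'o
  assumes "category C"
    and "c \<in> Ob C"
    and "finite_category C"
    and "acyclic_category C"
    and "monic_category C"
    and "left_locally_totally_ordered_category C"
  shows "finite_category (slice C c) \<and> acyclic_category (slice C c) \<and>
      monic_category (slice C c) \<and> left_locally_totally_ordered_category (slice C c) \<and>
      finite_category (coslice C c) \<and> acyclic_category (coslice C c) \<and>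
      monic_category (coslice C c) \<and> left_locally_totally_ordered_category (coslice C c) \<and>
      weakly_word_embeddable (slice C c) \<and> weakly_word_embeddable (coslice C c)"
  \<comment> \<open>The last two conjuncts apply the embedding theorem to the slice and the coslice,
    with the inherited properties as its hypotheses.\<close>
  using assms
  by (simp add: finite_category_slice finite_category_coslice
      acyclic_category_slice acyclic_category_coslice monic_category_slice monic_category_coslice
      left_locally_totally_ordered_category_slice left_locally_totally_ordered_category_coslice
      weakly_word_embeddable_if_left_locally_totally_ordered)

end
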